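(* Let $K, M\in\mathbb{C}^{n\times n}$ be invertible, let $0\neq b\in\mathbb{C}^n$, let $\sigma\in\mathbb{C}$ be such that $K+\sigma M$ is invertible, and let $\tau_1,\dots,\tau_m\in\mathbb{C}$ be such that each $K+\tau_k M$ is invertible. Let $Z_m$, $\bar H_m$ and $V_{m+1}$ be computed by $m$ steps of the flexible Arnoldi algorithm (described in the context), and let $H_m$ and $H_m(\sigma;T_m)$ be the associated $m\times m$ matrices, assumed invertible. Let $(\theta_k,f_k)$, $k=1,\dots,m$, be eigenpairs of the generalized eigenvalue problem $H_m(\sigma;T_m)f=\theta H_m f$, let $\Theta=\mathrm{diag}\{\theta_1,\dots,\theta_m\}$, and assume that the matrix of generalized eigenvectors $F=[f_1,\dots,f_m]$ is invertible, so that $H_m(\sigma;T_m)=H_mF\Theta F^{-1}$. Assume also $\theta_k+\tau_m-\sigma\neq 0$ for all $k$. Let $u_k:=V_{m+1}\bar H_mf_k$ and $$\rho_k:=\|(K+\sigma M)M^{-1}u_k-\theta_ku_k\|_2,\qquad s_k:=e_k^*F^{-1}\left(H_m^{-1}\beta e_1\right).$$ Then the residual $r_m(\sigma)$ of the flexible full orthogonalization method (FFOM) for $(K+\sigma M)x=b$ satisfies $$\|r_m(\sigma)\|_2\le\sum_{k=1}^m\rho_k\left|\frac{\sigma-\tau_m}{\theta_k+\tau_m-\sigma}\right|\,|\theta_k^{-1}|\,|s_k| .$$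
   Context: Notation: $\|\cdot\|_2$ is the Euclidean norm, $^*$ is the conjugate transpose, $e_k$ is the $k$-th canonical basis vector (of $\mathbb{C}^m$ here). Flexible Arnoldi algorithm (modified Gram--Schmidt): set $\beta=\|b\|_2$, $v_1=b/\beta$, and initialize the $(m+1)\times m$ matrix $\bar H_m=(h_{i,k})$ to zero. For $k=1,\dots,m$: solve $(K+\tau_kM)z_k=v_k$; set $w_k:=Mz_k$; for $i=1,\dots,k$ set $h_{i,k}:=v_i^*w_k$ and replace $w_k$ by $w_k-h_{i,k}v_i$; then set $h_{k+1,k}:=\|w_k\|_2$, stop if $h_{k+1,k}=0$, and otherwise set $v_{k+1}:=w_k/h_{k+1,k}$. It is understood that the $m$ steps have been completed without stopping, so that $v_1,\dots,v_{m+1}$ are all defined (and orthonormal). Set $V_m=[v_1,\dots,v_m]$, $V_{m+1}=[v_1,\dots,v_{m+1}]$, $Z_m=[z_1,\dots,z_m]$, $T_m=\mathrm{diag}\{\tau_1,\dots,\tau_m\}$. Thus $MZ_m=V_{m+1}\bar H_m$ and $KZ_m+MZ_mT_m=V_m$. Let $H_m$ be the $m\times m$ matrix consisting of the first $m$ rows of $\bar H_m$. Define $$\bar H_m(\sigma;T_m)=\begin{bmatrix}I_m\\0\end{bmatrix}+\bar H_m(\sigma I_m-T_m)\in\mathbb{C}^{(m+1)\times m},\qquad H_m(\sigma;T_m)=I_m+H_m(\sigma I_m-T_m)\in\mathbb{C}^{m\times m}.$$ FFOM: with zero initial guess, the approximate solution of $(K+\sigma M)x=b$ is $x_m(\sigma)=Z_my_m(\sigma)$,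 where $y_m(\sigma)\in\mathbb{C}^m$ solves $H_m(\sigma;T_m)y_m(\sigma)=\beta e_1$. Its residual is $r_m(\sigma)=b-(K+\sigma M)x_m(\sigma)$. *)

theory Defs
  imports
    "Jordan_Normal_Form.Gauss_Jordan_Elimination"
    "HOL-Analysis.L2_Norm"
begin

text \<open>
  Matrices and vectors are indexed from \<open>0\<close>: the quantities usually written
  \<open>v\<^sub>1, \<dots>, v\<^sub>m\<^sub>+\<^sub>1\<close>, \<open>\<tau>\<^sub>1, \<dots>, \<tau>\<^sub>m\<close>, \<open>e\<^sub>1\<close> are \<open>col V 0, \<dots>, col V m\<close>,
  \<open>\<tau> 0, \<dots>, \<tau> (m - 1)\<close>, \<open>unit_vec m 0\<close>.
  Since \<open>(\<bullet>c)\<close> conjugates its second argument, \<open>x\<^sup>* y\<close> is \<open>y \<bullet>c x\<close>.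
\<close>

definition norm2 :: "complex vec \<Rightarrow> real" where
  "norm2 x = L2_set (\<lambda>i. cmod (x $ i)) {..<dim_vec x}"

text \<open>Only meaningful for invertible \<open>A\<close>; unspecified otherwise.\<close>

abbreviation inv_mat :: "complex mat \<Rightarrow> complex mat" where
  "inv_mat A \<equiv> the (mat_inverse A)"

text \<open>
  \<open>mgs V w i\<close> is the value of the working vector after it has been orthogonalized, one
  after the other, against the first \<open>i\<close> columns of \<open>V\<close> (inner loop of modified Gram--Schmidt).
\<close>

primrec mgs :: "complex mat \<Rightarrow> complex vec \<Rightarrow> nat \<Rightarrow> complex vec" where
  "mgs V w 0 = w"
| "mgs V w (Suc i) = mgs V w i - (mgs V w i \<bullet>c col V i) \<cdot>\<^sub>v col V i"

text \<open>
  \<open>V\<close>, \<open>Z\<close>, \<open>Hbar\<close> are the output of \<open>m\<close> steps of the flexible Arnoldi algorithm, completed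
  without breakdown (all subdiagonal entries of \<open>Hbar\<close> are nonzero, including the one
  produced by the last step).
\<close>

definition flexible_arnoldi ::
  "nat \<Rightarrow> nat \<Rightarrow> complex mat \<Rightarrow> complex mat \<Rightarrow> complex vec \<Rightarrow> (nat \<Rightarrow> complex) \<Rightarrow>
   complex mat \<Rightarrow> complex mat \<Rightarrow> complex mat \<Rightarrow> bool" where
  "flexible_arnoldi n m K M b \<tau> V Z Hbar \<longleftrightarrow>
     V \<in> carrier_mat n (m + 1) \<and> Z \<in> carrier_mat n m \<and> Hbar \<in> carrier_mat (m + 1) m \<and>
     col V 0 = complex_of_real (1 / norm2 b) \<cdot>\<^sub>v b \<and>
     (\<forall>k<m.
        (K + \<tau> k \<cdot>\<^sub>m M) *\<^sub>v col Z k = col V k \<and>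
        (\<forall>i\<le>k. Hbar $$ (i, k) = mgs V (M *\<^sub>v col Z k) i \<bullet>c col V i) \<and>
        Hbar $$ (k + 1, k) = complex_of_real (norm2 (mgs V (M *\<^sub>v col Z k) (k + 1))) \<and>
        Hbar $$ (k + 1, k) \<noteq> 0 \<and>
        col V (k + 1) = (1 / Hbar $$ (k + 1, k)) \<cdot>\<^sub>v mgs V (M *\<^sub>v col Z k) (k + 1) \<and>
        (\<forall>i. k + 1 < i \<and> i \<le> m \<longrightarrow> Hbar $$ (i, k) = 0))"

definition first_rows :: "nat \<Rightarrow> complex mat \<Rightarrow> complex mat" where
  "first_rows k A = mat k (dim_col A) (\<lambda>(i, j). A $$ (i, j))"

definition shifted_hess ::
  "nat \<Rightarrow> complex mat \<Rightarrow> (nat \<Rightarrow> complex) \<Rightarrow> complex \<Rightarrow> complex mat" where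
  "shifted_hess m H \<tau> \<sigma> = 1\<^sub>m m + H * (\<sigma> \<cdot>\<^sub>m 1\<^sub>m m - mat_diag m \<tau>)"

definition gen_eigenpair ::
  "complex mat \<Rightarrow> complex mat \<Rightarrow> complex \<Rightarrow> complex vec \<Rightarrow> bool" where
  "gen_eigenpair A B \<theta> f \<longleftrightarrow>
     f \<in> carrier_vec (dim_col A) \<and> f \<noteq> 0\<^sub>v (dim_col A) \<and> A *\<^sub>v f = \<theta> \<cdot>\<^sub>v (B *\<^sub>v f)"

text \<open>
  \<open>x\<close> is the FFOM approximation (zero initial guess) to the solution of
  \<open>(K + \<sigma> M) x = b\<close>, where \<open>Z\<close> and \<open>Hbar\<close> come from the flexible Arnoldi algorithm for \<open>b\<close>.
\<close>

definition ffom_approx ::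
  "nat \<Rightarrow> complex vec \<Rightarrow> (nat \<Rightarrow> complex) \<Rightarrow> complex mat \<Rightarrow> complex mat \<Rightarrow> complex \<Rightarrow>
   complex vec \<Rightarrow> bool" where
  "ffom_approx m b \<tau> Z Hbar \<sigma> x \<longleftrightarrow>
     (\<exists>y \<in> carrier_vec m.
        shifted_hess m (first_rows m Hbar) \<tau> \<sigma> *\<^sub>v y
          = complex_of_real (norm2 b) \<cdot>\<^sub>v unit_vec m 0 \<and>
        x = Z *\<^sub>v y)"

end

theory Submission
  imports Defs
begin

text \<open>
  Write \<open>h\<close> for the last subdiagonal entry \<open>h\<^bsub>m+1,m\<^esub>\<close>, \<open>v\<close> for the last basis vector
  \<open>v\<^bsub>m+1\<^esub>\<close> and \<open>d = \<sigma> - \<tau>\<^sub>m\<close>. Every residual in the theorem is a multiple of \<open>v\<close>. Indeed the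
  Arnoldi process gives \<open>M Z = V\<^bsub>m+1\<^esub> Hbar\<close> and \<open>(K + \<sigma> M) Z = V\<^bsub>m+1\<^esub> G\<close>, where \<open>G\<close> is the
  rectangular shifted Hessenberg matrix (\<open>arnoldi_relation\<close>, \<open>shifted_arnoldi_relation\<close>). The
  first \<open>m\<close> rows of \<open>G\<close> form \<open>H\<^sub>m(\<sigma>; T\<^sub>m)\<close>, so the square eigenvalue equation and the square
  FFOM equation cancel the components along \<open>v\<^sub>1, \<dots>, v\<^sub>m\<close>, and what survives comes from the
  last rows of \<open>Hbar\<close> and \<open>G\<close>. These rows have a single nonzero entry, \<open>h\<close> and \<open>d h\<close>. Hence

  \<^item> the eigenpair \<open>(\<theta>\<^sub>k, f\<^sub>k)\<close> has the residual \<open>(d - \<theta>\<^sub>k) h (f\<^sub>k)\<^sub>m v\<close>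
    (\<open>eigen_residual_along_last_vector\<close>), whose norm is \<open>\<rho>\<^sub>k\<close>;
  \<^item> FFOM has the residual \<open>- d h y\<^sub>m v\<close> (\<open>ffom_residual_along_last_vector\<close>).

  From \<open>H\<^sub>m(\<sigma>; T\<^sub>m) F = H\<^sub>m F \<Theta>\<close> one gets \<open>y = F \<Theta>\<^sup>-\<^sup>1 F\<^sup>-\<^sup>1 H\<^sub>m\<^sup>-\<^sup>1 \<beta> e\<^sub>1\<close>
  (\<open>diagonalized_pencil_solution\<close>), that is \<open>y\<^sub>m = \<Sum>\<^sub>k (f\<^sub>k)\<^sub>m \<theta>\<^sub>k\<^sup>-\<^sup>1 s\<^sub>k\<close>. The triangle
  inequality for \<open>\<bar>y\<^sub>m\<bar>\<close> is the only estimate: each of its terms equals the corresponding term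
  of the bound, because \<open>\<bar>h (f\<^sub>k)\<^sub>m\<bar> \<parallel>v\<parallel>\<^sub>2 = \<rho>\<^sub>k / \<bar>\<theta>\<^sub>k - d\<bar>\<close>.
\<close>

section \<open>Norms, inverses and matrix-vector products\<close>

lemma mult_mat_vec_index_sum:
  assumes "A \<in> carrier_mat p m" and "y \<in> carrier_vec m" and "i < p"
  shows "(A *\<^sub>v y) $ i = (\<Sum>k<m. A $$ (i, k) * y $ k)"
  using assms by (simp add: scalar_prod_def atLeast0LessThan)

lemma norm2_smult: "norm2 (c \<cdot>\<^sub>v x) = cmod c * norm2 x"
proof -
  have "norm2 (c \<cdot>\<^sub>v x) = L2_set (\<lambda>i. cmod c * cmod (x $ i)) {..<dim_vec x}"
    unfolding norm2_def by (rule L2_set_cong) (auto simp: norm_mult)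
  then show ?thesis by (simp add: norm2_def L2_set_right_distrib)
qed

lemma norm2_eq_0_imp_zero_vec:
  assumes "norm2 x = 0"
  shows "x = 0\<^sub>v (dim_vec x)"
  using assms by (intro eq_vecI) (auto simp: norm2_def L2_set_eq_0_iff)

text \<open>
  The inverse comes from a Gauss--Jordan procedure whose correctness is stated through the units
  of the matrix ring, so an inverse in the sense of \<^const>\<open>invertible_mat\<close> has to be exhibited as
  a unit.
\<close>

lemma invertible_mat_inv_mat:
  assumes A: "A \<in> carrier_mat n n" and inv: "invertible_mat A"
  shows "inv_mat A \<in> carrier_mat n n" "A * inv_mat A = 1\<^sub>m n" "inv_mat A * A = 1\<^sub>m n"
proof -
  obtain B where "inverts_mat A B" "inverts_mat B A"
    using inv by (auto simp: invertible_mat_def)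
  then have AB: "A * B = 1\<^sub>m n" and BA: "B * A = 1\<^sub>m (dim_row B)"
    using A by (auto simp: inverts_mat_def)
  have B: "B \<in> carrier_mat n n"
    using arg_cong[OF AB, of dim_col] arg_cong[OF BA, of dim_col] A by auto
  obtain C where C: "mat_inverse A = Some C"
  proof (cases "mat_inverse A")
    case None
    have "A \<in> Units (ring_mat TYPE(complex) n ())"
      using A B AB BA by (auto simp: Units_def ring_mat_def)
    with mat_inverse(1)[OF A None, of "()"] show ?thesis by blast
  qed
  from mat_inverse(2)[OF A C]
  show "inv_mat A \<in> carrier_mat n n" "A * inv_mat A = 1\<^sub>m n" "inv_mat A * A = 1\<^sub>m n"
    by (auto simp: C)
qed

lemma invertible_mat_mult_vec_cancel:
  fixes A :: "complex mat"
  assumes A: "A \<in> carrier_mat n n" and inv: "invertible_mat A"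
    and x: "x \<in> carrier_vec n" and y: "y \<in> carrier_vec n"
    and eq: "A *\<^sub>v x = A *\<^sub>v y"
  shows "x = y"
proof -
  note B = invertible_mat_inv_mat[OF A inv]
  have "x = inv_mat A *\<^sub>v (A *\<^sub>v x)"
    using B A x by (simp flip: assoc_mult_mat_vec)
  also have "\<dots> = inv_mat A *\<^sub>v (A *\<^sub>v y)"
    by (simp only: eq)
  also have "\<dots> = y"
    using B A y by (simp flip: assoc_mult_mat_vec)
  finally show ?thesis .
qed

section \<open>The flexible Arnoldi relations\<close>

lemma dim_vec_mgs:
  assumes "V \<in> carrier_mat n p" and "w \<in> carrier_vec n"
  shows "dim_vec (mgs V w j) = n"
  using assms by (induction j) auto

text \<open>
  Telescoping the orthogonalization steps: the original vector is recovered from the working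
  vector by adding back the subtracted components. Entrywise this avoids sums of vectors.
\<close>

lemma mgs_index:
  assumes V: "V \<in> carrier_mat n p" and w: "w \<in> carrier_vec n" and i: "i < n" and "j \<le> p"
  shows "mgs V w j $ i = w $ i - (\<Sum>l<j. V $$ (i, l) * (mgs V w l \<bullet>c col V l))"
  using \<open>j \<le> p\<close>
proof (induction j)
  case (Suc j)
  then show ?case
    using V i dim_vec_mgs[OF V w, of j] by simp
qed simp

text \<open>
  The \<open>k\<close>-th column of \<open>Hbar\<close> records exactly the components that the Gram--Schmidt loop
  subtracts from \<open>M z\<^sub>k\<close>, and its subdiagonal entry rescales the next basis vector to what
  remains after the loop.
\<close>

lemma arnoldi_relation:
  assumes M: "M \<in> carrier_mat n n" and ar: "flexible_arnoldi n m K M b \<tau> V Z Hbar"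
  shows "M * Z = V * Hbar"
proof (rule eq_matI)
  have V: "V \<in> carrier_mat n (m + 1)" and Z: "Z \<in> carrier_mat n m"
    and Hb: "Hbar \<in> carrier_mat (m + 1) m"
    using ar by (auto simp: flexible_arnoldi_def)
  show "dim_row (M * Z) = dim_row (V * Hbar)" "dim_col (M * Z) = dim_col (V * Hbar)"
    using V Z Hb M by auto
  fix i k assume "i < dim_row (V * Hbar)" "k < dim_col (V * Hbar)"
  then have i: "i < n" and k: "k < m" using V Hb by auto
  define w where "w = M *\<^sub>v col Z k"
  have w: "w \<in> carrier_vec n" using M Z k by (auto simp: w_def intro!: mult_mat_vec_carrier)
  have h: "Hbar $$ (l, k) = mgs V w l \<bullet>c col V l" if "l \<le> k" for l
    using ar k that by (auto simp: flexible_arnoldi_def w_def)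
  have h1: "Hbar $$ (k + 1, k) \<noteq> 0"
    and v1: "col V (k + 1) = (1 / Hbar $$ (k + 1, k)) \<cdot>\<^sub>v mgs V w (k + 1)"
    using ar k unfolding flexible_arnoldi_def w_def by blast+
  have h0: "Hbar $$ (l, k) = 0" if "k + 1 < l" "l \<le> m" for l
    using ar k that unfolding flexible_arnoldi_def by blast
  have V1: "V $$ (i, k + 1) * Hbar $$ (k + 1, k) = mgs V w (k + 1) $ i"
  proof -
    have "V $$ (i, k + 1) = col V (k + 1) $ i"
      using V i k by simp
    also have "\<dots> = mgs V w (k + 1) $ i / Hbar $$ (k + 1, k)"
      unfolding v1 using i dim_vec_mgs[OF V w, of "k + 1"] by (simp del: mgs.simps)
    finally show ?thesis using h1 by simp
  qed
  have "(V * Hbar) $$ (i, k) = (\<Sum>l<m + 1. V $$ (i, l) * Hbar $$ (l, k))"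
    using V Hb i k by (simp add: scalar_prod_def atLeast0LessThan)
  also have "\<dots> = (\<Sum>l<k + 2. V $$ (i, l) * Hbar $$ (l, k))"
    using k h0 by (intro sum.mono_neutral_right) auto
  also have "\<dots> = (\<Sum>l<k + 1. V $$ (i, l) * (mgs V w l \<bullet>c col V l)) + mgs V w (k + 1) $ i"
    using h V1 by simp
  also have "\<dots> = w $ i"
    using mgs_index[OF V w i, of "k + 1"] k by simp
  also have "\<dots> = (M * Z) $$ (i, k)"
    using M Z i k by (simp add: w_def)
  finally show "(M * Z) $$ (i, k) = (V * Hbar) $$ (i, k)" by simp
qed

text \<open>The rectangular matrix \<open>Hbar\<^sub>m(\<sigma>; T\<^sub>m) = [I\<^sub>m; 0] + Hbar\<^sub>m (\<sigma> I\<^sub>m - T\<^sub>m)\<close>, by entries.\<close>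

definition shifted_hess_bar ::
  "nat \<Rightarrow> complex mat \<Rightarrow> (nat \<Rightarrow> complex) \<Rightarrow> complex \<Rightarrow> complex mat" where
  "shifted_hess_bar m Hbar \<tau> \<sigma> =
     mat (m + 1) m (\<lambda>(i, j). of_bool (i = j) + Hbar $$ (i, j) * (\<sigma> - \<tau> j))"

text \<open>
  Each column only has to change its own shift:
  \<open>(K + \<sigma> M) z\<^sub>k = (K + \<tau>\<^sub>k M) z\<^sub>k + (\<sigma> - \<tau>\<^sub>k) M z\<^sub>k\<close>, where the first summand is \<open>v\<^sub>k\<close> by the
  choice of \<open>z\<^sub>k\<close> and the second one is given by the Arnoldi relation.
\<close>

lemma shifted_arnoldi_relation:
  assumes K: "K \<in> carrier_mat n n" and M: "M \<in> carrier_mat n n"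
    and ar: "flexible_arnoldi n m K M b \<tau> V Z Hbar"
  shows "(K + \<sigma> \<cdot>\<^sub>m M) * Z = V * shifted_hess_bar m Hbar \<tau> \<sigma>"
proof (rule eq_matI)
  have V: "V \<in> carrier_mat n (m + 1)" and Z: "Z \<in> carrier_mat n m"
    and Hb: "Hbar \<in> carrier_mat (m + 1) m"
    using ar by (auto simp: flexible_arnoldi_def)
  show "dim_row ((K + \<sigma> \<cdot>\<^sub>m M) * Z) = dim_row (V * shifted_hess_bar m Hbar \<tau> \<sigma>)"
    "dim_col ((K + \<sigma> \<cdot>\<^sub>m M) * Z) = dim_col (V * shifted_hess_bar m Hbar \<tau> \<sigma>)"
    using V Z M by (auto simp: shifted_hess_bar_def)
  fix i k
  assume "i < dim_row (V * shifted_hess_bar m Hbar \<tau> \<sigma>)"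
    "k < dim_col (V * shifted_hess_bar m Hbar \<tau> \<sigma>)"
  then have i: "i < n" and k: "k < m" using V by (auto simp: shifted_hess_bar_def)
  have entry: "((K + \<mu> \<cdot>\<^sub>m M) * Z) $$ (i, k) = (K * Z) $$ (i, k) + \<mu> * (M * Z) $$ (i, k)" for \<mu>
    using K M Z i k
    by (simp add: scalar_prod_def sum.distrib sum_distrib_left algebra_simps)
  have "(K + \<tau> k \<cdot>\<^sub>m M) *\<^sub>v col Z k = col V k"
    using ar k by (auto simp: flexible_arnoldi_def)
  from arg_cong[OF this, of "\<lambda>v. v $ i"]
  have "((K + \<tau> k \<cdot>\<^sub>m M) * Z) $$ (i, k) = V $$ (i, k)"
    using K M Z V i k by simp
  then have "((K + \<sigma> \<cdot>\<^sub>m M) * Z) $$ (i, k) = V $$ (i, k) + (\<sigma> - \<tau> k) * (V * Hbar) $$ (i, k)"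
    unfolding entry arnoldi_relation[OF M ar] by (simp add: algebra_simps)
  also have "V $$ (i, k) = (\<Sum>l<m + 1. V $$ (i, l) * of_bool (l = k))"
    using k by (subst sum.remove[of _ k]) auto
  also have "(V * Hbar) $$ (i, k) = (\<Sum>l<m + 1. V $$ (i, l) * Hbar $$ (l, k))"
    using V Hb i k by (simp add: scalar_prod_def atLeast0LessThan)
  also have "(\<Sum>l<m + 1. V $$ (i, l) * of_bool (l = k))
      + (\<sigma> - \<tau> k) * (\<Sum>l<m + 1. V $$ (i, l) * Hbar $$ (l, k))
    = (\<Sum>l<m + 1. V $$ (i, l) * shifted_hess_bar m Hbar \<tau> \<sigma> $$ (l, k))"
    unfolding sum_distrib_left sum.distrib[symmetric]
    using k by (intro sum.cong) (auto simp: shifted_hess_bar_def algebra_simps)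
  also have "\<dots> = (V * shifted_hess_bar m Hbar \<tau> \<sigma>) $$ (i, k)"
    using V i k by (simp add: scalar_prod_def atLeast0LessThan shifted_hess_bar_def)
  finally show "((K + \<sigma> \<cdot>\<^sub>m M) * Z) $$ (i, k) = (V * shifted_hess_bar m Hbar \<tau> \<sigma>) $$ (i, k)" .
qed

lemma first_rows_mult_vec_index:
  assumes "A \<in> carrier_mat p m" and "y \<in> carrier_vec m" and "i < k" and "k \<le> p"
  shows "(first_rows k A *\<^sub>v y) $ i = (A *\<^sub>v y) $ i"
  using assms by (simp add: first_rows_def scalar_prod_def)

lemma first_rows_shifted_hess_bar:
  assumes "Hbar \<in> carrier_mat (m + 1) m"
  shows "first_rows m (shifted_hess_bar m Hbar \<tau> \<sigma>) = shifted_hess m (first_rows m Hbar) \<tau> \<sigma>"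
proof (rule eq_matI)
  fix i k
  assume "i < dim_row (shifted_hess m (first_rows m Hbar) \<tau> \<sigma>)"
    "k < dim_col (shifted_hess m (first_rows m Hbar) \<tau> \<sigma>)"
  then have i: "i < m" and k: "k < m"
    using assms by (auto simp: shifted_hess_def first_rows_def mat_diag_def)
  have "(first_rows m Hbar * (\<sigma> \<cdot>\<^sub>m 1\<^sub>m m - mat_diag m \<tau>)) $$ (i, k)
      = (\<Sum>l<m. Hbar $$ (i, l) * (if l = k then \<sigma> - \<tau> k else 0))"
    using assms i k
    by (auto simp: first_rows_def scalar_prod_def mat_diag_def atLeast0LessThan intro!: sum.cong)
  also have "\<dots> = Hbar $$ (i, k) * (\<sigma> - \<tau> k)"
    using k by (subst sum.remove[of _ k]) auto
  finally show "first_rows m (shifted_hess_bar m Hbar \<tau> \<sigma>) $$ (i, k)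
      = shifted_hess m (first_rows m Hbar) \<tau> \<sigma> $$ (i, k)"
    using assms i k
    by (simp add: shifted_hess_def shifted_hess_bar_def first_rows_def mat_diag_def del: index_mult_mat(1))
qed (use assms in \<open>auto simp: shifted_hess_def shifted_hess_bar_def first_rows_def mat_diag_def\<close>)

lemma last_row_mult_vec:
  fixes A :: "'a :: comm_ring_1 mat"
  assumes "A \<in> carrier_mat (m + 1) m" and "y \<in> carrier_vec m" and "m \<ge> 1"
    and zero: "\<And>l. l + 1 < m \<Longrightarrow> A $$ (m, l) = 0"
  shows "(A *\<^sub>v y) $ m = A $$ (m, m - 1) * y $ (m - 1)"
proof -
  have "(A *\<^sub>v y) $ m = (\<Sum>l<m. A $$ (m, l) * y $ l)"
    using assms(1,2) by (intro mult_mat_vec_index_sum) auto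
  also have "\<dots> = (\<Sum>l\<in>{m - 1}. A $$ (m, l) * y $ l)"
  proof (rule sum.mono_neutral_right)
    show "\<forall>l\<in>{..<m} - {m - 1}. A $$ (m, l) * y $ l = 0"
    proof
      fix l assume "l \<in> {..<m} - {m - 1}"
      then have "l + 1 < m" by auto
      then show "A $$ (m, l) * y $ l = 0" using zero by simp
    qed
  qed (use assms(3) in auto)
  finally show ?thesis by simp
qed

lemma mult_vec_supported_on_last:
  fixes V :: "'a :: comm_ring_1 mat"
  assumes "V \<in> carrier_mat n (m + 1)" and "w \<in> carrier_vec (m + 1)"
    and "\<And>i. i < m \<Longrightarrow> w $ i = 0"
  shows "V *\<^sub>v w = w $ m \<cdot>\<^sub>v col V m"
  using assms by (intro eq_vecI) (auto simp: scalar_prod_def)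

section \<open>Residuals of eigenpairs and of FFOM\<close>

context
  fixes n m :: nat and K M V Z Hbar :: "complex mat" and b :: "complex vec"
    and \<sigma> :: complex and \<tau> :: "nat \<Rightarrow> complex"
  assumes m: "m \<ge> 1" and K: "K \<in> carrier_mat n n" and M: "M \<in> carrier_mat n n"
    and ar: "flexible_arnoldi n m K M b \<tau> V Z Hbar"
begin

lemma arnoldi_carriers:
  shows "V \<in> carrier_mat n (m + 1)" "Z \<in> carrier_mat n m" "Hbar \<in> carrier_mat (m + 1) m"
    "shifted_hess_bar m Hbar \<tau> \<sigma> \<in> carrier_mat (m + 1) m"
  using ar by (auto simp: flexible_arnoldi_def shifted_hess_bar_def)

lemma hess_bar_last_row:
  assumes f: "f \<in> carrier_vec m"
  shows "(Hbar *\<^sub>v f) $ m = Hbar $$ (m, m - 1) * f $ (m - 1)"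
    and "(shifted_hess_bar m Hbar \<tau> \<sigma> *\<^sub>v f) $ m
      = (\<sigma> - \<tau> (m - 1)) * Hbar $$ (m, m - 1) * f $ (m - 1)"
proof -
  have z: "Hbar $$ (m, l) = 0" if "l + 1 < m" for l
    using ar that m by (auto simp: flexible_arnoldi_def)
  show "(Hbar *\<^sub>v f) $ m = Hbar $$ (m, m - 1) * f $ (m - 1)"
    using arnoldi_carriers f m z by (intro last_row_mult_vec)
  have "(shifted_hess_bar m Hbar \<tau> \<sigma> *\<^sub>v f) $ m
      = shifted_hess_bar m Hbar \<tau> \<sigma> $$ (m, m - 1) * f $ (m - 1)"
    using arnoldi_carriers f m z by (intro last_row_mult_vec) (auto simp: shifted_hess_bar_def)
  then show "(shifted_hess_bar m Hbar \<tau> \<sigma> *\<^sub>v f) $ m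
      = (\<sigma> - \<tau> (m - 1)) * Hbar $$ (m, m - 1) * f $ (m - 1)"
    using m by (simp add: shifted_hess_bar_def of_bool_def)
qed

text \<open>
  Since \<open>u = M Z f\<close>, the inverse of \<open>M\<close> cancels and the residual is
  \<open>V (G f - \<theta> Hbar f)\<close>. The eigenvalue equation says that the first \<open>m\<close> entries of the vector
  in parentheses vanish.
\<close>

lemma eigen_residual_along_last_vector:
  assumes f: "f \<in> carrier_vec m"
    and eig: "shifted_hess m (first_rows m Hbar) \<tau> \<sigma> *\<^sub>v f = \<theta> \<cdot>\<^sub>v (first_rows m Hbar *\<^sub>v f)"
    and inv: "invertible_mat M"
    and u: "u = V *\<^sub>v (Hbar *\<^sub>v f)"
  shows "(K + \<sigma> \<cdot>\<^sub>m M) *\<^sub>v (inv_mat M *\<^sub>v u) - \<theta> \<cdot>\<^sub>v u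
    = ((\<sigma> - \<tau> (m - 1) - \<theta>) * Hbar $$ (m, m - 1) * f $ (m - 1)) \<cdot>\<^sub>v col V m"
proof -
  note C = arnoldi_carriers
  define G where "G = shifted_hess_bar m Hbar \<tau> \<sigma>"
  have G: "G \<in> carrier_mat (m + 1) m" using C by (simp add: G_def)
  note Mi = invertible_mat_inv_mat[OF M inv]
  have "u = M *\<^sub>v (Z *\<^sub>v f)"
    using M C f by (simp add: u arnoldi_relation[OF M ar] flip: assoc_mult_mat_vec)
  then have "inv_mat M *\<^sub>v u = (inv_mat M * M) *\<^sub>v (Z *\<^sub>v f)"
    using M Mi(1) C f by simp
  then have "inv_mat M *\<^sub>v u = Z *\<^sub>v f"
    using Mi(3) C f by simp
  then have "(K + \<sigma> \<cdot>\<^sub>m M) *\<^sub>v (inv_mat M *\<^sub>v u) = ((K + \<sigma> \<cdot>\<^sub>m M) * Z) *\<^sub>v f"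
    using K M C f by (simp add: assoc_mult_mat_vec[of _ n n])
  also have "\<dots> = V *\<^sub>v (G *\<^sub>v f)"
    using C f by (simp add: shifted_arnoldi_relation[OF K M ar] G_def)
  finally have "(K + \<sigma> \<cdot>\<^sub>m M) *\<^sub>v (inv_mat M *\<^sub>v u) - \<theta> \<cdot>\<^sub>v u
      = V *\<^sub>v (G *\<^sub>v f - \<theta> \<cdot>\<^sub>v (Hbar *\<^sub>v f))"
    using C G f by (simp add: u mult_minus_distrib_mat_vec mult_mat_vec)
  also have "\<dots> = (G *\<^sub>v f - \<theta> \<cdot>\<^sub>v (Hbar *\<^sub>v f)) $ m \<cdot>\<^sub>v col V m"
  proof (rule mult_vec_supported_on_last)
    fix i assume i: "i < m"
    have "(G *\<^sub>v f) $ i = (first_rows m G *\<^sub>v f) $ i"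
      using first_rows_mult_vec_index[OF G f i] by simp
    also have "\<dots> = (\<theta> \<cdot>\<^sub>v (first_rows m Hbar *\<^sub>v f)) $ i"
      using C by (simp add: G_def first_rows_shifted_hess_bar eig)
    also have "\<dots> = \<theta> * (first_rows m Hbar *\<^sub>v f) $ i"
      using i by (simp add: first_rows_def)
    also have "\<dots> = \<theta> * (Hbar *\<^sub>v f) $ i"
      using first_rows_mult_vec_index[OF C(3) f i] by simp
    finally show "(G *\<^sub>v f - \<theta> \<cdot>\<^sub>v (Hbar *\<^sub>v f)) $ i = 0"
      using C i by simp
  qed (use C G f in auto)
  also have "(G *\<^sub>v f - \<theta> \<cdot>\<^sub>v (Hbar *\<^sub>v f)) $ m = (G *\<^sub>v f) $ m - \<theta> * (Hbar *\<^sub>v f) $ m"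
    using C by simp
  also have "\<dots> = (\<sigma> - \<tau> (m - 1) - \<theta>) * Hbar $$ (m, m - 1) * f $ (m - 1)"
    unfolding G_def hess_bar_last_row[OF f] by (simp add: algebra_simps)
  finally show ?thesis .
qed

text \<open>
  Because \<open>b = \<beta> v\<^sub>1 = V (\<beta> e\<^sub>1)\<close>, the residual is \<open>V (\<beta> e\<^sub>1 - G y)\<close>. The FFOM equation says
  that the first \<open>m\<close> entries of the vector in parentheses vanish; the last entry of
  \<open>\<beta> e\<^sub>1\<close> is zero because \<open>m \<ge> 1\<close>.
\<close>

lemma ffom_residual_along_last_vector:
  assumes b: "b \<in> carrier_vec n" and b0: "b \<noteq> 0\<^sub>v n" and y: "y \<in> carrier_vec m"
    and sol: "shifted_hess m (first_rows m Hbar) \<tau> \<sigma> *\<^sub>v y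
      = complex_of_real (norm2 b) \<cdot>\<^sub>v unit_vec m 0"
  shows "b - (K + \<sigma> \<cdot>\<^sub>m M) *\<^sub>v (Z *\<^sub>v y)
    = (- ((\<sigma> - \<tau> (m - 1)) * Hbar $$ (m, m - 1) * y $ (m - 1))) \<cdot>\<^sub>v col V m"
proof -
  note C = arnoldi_carriers
  define G where "G = shifted_hess_bar m Hbar \<tau> \<sigma>"
  define e where "e = complex_of_real (norm2 b) \<cdot>\<^sub>v unit_vec (m + 1) 0"
  have G: "G \<in> carrier_mat (m + 1) m" using C by (simp add: G_def)
  have e: "e \<in> carrier_vec (m + 1)" by (simp add: e_def)
  have "norm2 b \<noteq> 0"
    using b b0 norm2_eq_0_imp_zero_vec[of b] by auto
  moreover have "col V 0 = complex_of_real (1 / norm2 b) \<cdot>\<^sub>v b"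
    using ar by (simp add: flexible_arnoldi_def)
  ultimately have "complex_of_real (norm2 b) \<cdot>\<^sub>v col V 0 = b"
    using b by (simp add: smult_smult_assoc)
  moreover have "V *\<^sub>v unit_vec (m + 1) 0 = col V 0"
    using C(1) by (intro eq_vecI) (auto simp: scalar_prod_right_unit)
  ultimately have be: "V *\<^sub>v e = b"
    using C(1) by (simp add: e_def mult_mat_vec)
  have "(K + \<sigma> \<cdot>\<^sub>m M) *\<^sub>v (Z *\<^sub>v y) = ((K + \<sigma> \<cdot>\<^sub>m M) * Z) *\<^sub>v y"
    using K M C y by (simp add: assoc_mult_mat_vec[of _ n n])
  also have "\<dots> = V *\<^sub>v (G *\<^sub>v y)"
    using C y by (simp add: shifted_arnoldi_relation[OF K M ar] G_def)
  finally have "b - (K + \<sigma> \<cdot>\<^sub>m M) *\<^sub>v (Z *\<^sub>v y) = V *\<^sub>v (e - G *\<^sub>v y)"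
    using C G e y by (simp add: mult_minus_distrib_mat_vec be)
  also have "\<dots> = (e - G *\<^sub>v y) $ m \<cdot>\<^sub>v col V m"
  proof (rule mult_vec_supported_on_last)
    fix i assume i: "i < m"
    have "(G *\<^sub>v y) $ i = (first_rows m G *\<^sub>v y) $ i"
      using first_rows_mult_vec_index[OF G y i] by simp
    also have "\<dots> = e $ i"
      using C i by (simp add: G_def first_rows_shifted_hess_bar sol e_def)
    finally show "(e - G *\<^sub>v y) $ i = 0"
      using G i by simp
  qed (use C G e y in auto)
  also have "(e - G *\<^sub>v y) $ m = - (G *\<^sub>v y) $ m"
    using G m by (simp add: e_def)
  finally show ?thesis
    unfolding G_def hess_bar_last_row[OF y] .
qed

end

section \<open>Solving with a diagonalized matrix pencil\<close>

text \<open>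
  The columns of \<open>F\<close> give \<open>A F = B F \<Theta>\<close>, so \<open>z = \<Theta>\<^sup>-\<^sup>1 F\<^sup>-\<^sup>1 B\<^sup>-\<^sup>1 c\<close> satisfies
  \<open>A F z = B F F\<^sup>-\<^sup>1 B\<^sup>-\<^sup>1 c = c\<close>, and \<open>A\<close> is injective. Injectivity also rules out
  \<open>\<theta>\<^sub>k = 0\<close>, so \<open>\<Theta>\<close> can be inverted.
\<close>

lemma diagonalized_pencil_solution:
  assumes A: "A \<in> carrier_mat m m" and inv: "invertible_mat A"
    and B: "B \<in> carrier_mat m m" and invB: "invertible_mat B"
    and F: "F \<in> carrier_mat m m" and invF: "invertible_mat F"
    and eig: "\<And>k. k < m \<Longrightarrow> gen_eigenpair A B (\<theta> k) (col F k)"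
    and y: "y \<in> carrier_vec m" and c: "c \<in> carrier_vec m" and sol: "A *\<^sub>v y = c"
  shows "y = F *\<^sub>v vec m (\<lambda>k. inverse (\<theta> k) * (inv_mat F *\<^sub>v (inv_mat B *\<^sub>v c)) $ k)"
proof -
  define t where "t = inv_mat F *\<^sub>v (inv_mat B *\<^sub>v c)"
  define z where "z = vec m (\<lambda>k. inverse (\<theta> k) * t $ k)"
  note Bi = invertible_mat_inv_mat[OF B invB] and Fi = invertible_mat_inv_mat[OF F invF]
  have t: "t \<in> carrier_vec m" using Fi(1) Bi(1) c by (auto simp: t_def intro!: mult_mat_vec_carrier)
  have z: "z \<in> carrier_vec m" by (simp add: z_def)
  have "B *\<^sub>v (F *\<^sub>v t) = B *\<^sub>v ((F * inv_mat F) *\<^sub>v (inv_mat B *\<^sub>v c))"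
    using F Fi(1) Bi(1) c by (simp add: t_def)
  also have "\<dots> = (B * inv_mat B) *\<^sub>v c"
    using B Fi(2) Bi(1) c by simp
  also have "\<dots> = c"
    using Bi(2) c by simp
  finally have BFt: "B *\<^sub>v (F *\<^sub>v t) = c" .
  have AF: "(A * F) $$ (i, k) = \<theta> k * (B * F) $$ (i, k)" if "i < m" "k < m" for i k
  proof -
    have "(A *\<^sub>v col F k) $ i = (\<theta> k \<cdot>\<^sub>v (B *\<^sub>v col F k)) $ i"
      using eig[OF \<open>k < m\<close>] by (simp add: gen_eigenpair_def)
    then show ?thesis using A B F that by simp
  qed
  have \<theta>: "\<theta> k \<noteq> 0" if k: "k < m" for k
  proof
    assume "\<theta> k = 0"
    with eig[OF k] have "A *\<^sub>v col F k = 0\<^sub>v m" and ne: "col F k \<noteq> 0\<^sub>v m"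
      using A B F by (auto simp: gen_eigenpair_def)
    moreover have "A *\<^sub>v 0\<^sub>v m = 0\<^sub>v m"
      using A by (intro eq_vecI) auto
    ultimately have "A *\<^sub>v col F k = A *\<^sub>v 0\<^sub>v m"
      by simp
    from invertible_mat_mult_vec_cancel[OF A inv _ _ this] ne F show False by auto
  qed
  have "A *\<^sub>v (F *\<^sub>v z) = (A * F) *\<^sub>v z"
    using A F z by simp
  also have "\<dots> = (B * F) *\<^sub>v t"
  proof (rule eq_vecI)
    fix i assume "i < dim_vec ((B * F) *\<^sub>v t)"
    then have i: "i < m" using B by simp
    have "((A * F) *\<^sub>v z) $ i = (\<Sum>k<m. (A * F) $$ (i, k) * z $ k)"
      using A F i z by (intro mult_mat_vec_index_sum) auto
    also have "\<dots> = (\<Sum>k<m. (B * F) $$ (i, k) * t $ k)"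
      using AF[OF i] \<theta> by (intro sum.cong) (auto simp: z_def simp del: index_mult_mat(1))
    also have "\<dots> = ((B * F) *\<^sub>v t) $ i"
      using B F i t by (intro mult_mat_vec_index_sum[symmetric]) auto
    finally show "((A * F) *\<^sub>v z) $ i = ((B * F) *\<^sub>v t) $ i" .
  qed (use A B in simp)
  also have "\<dots> = A *\<^sub>v y"
    using B F t by (simp add: BFt sol)
  finally have "y = F *\<^sub>v z"
    using invertible_mat_mult_vec_cancel[OF A inv y mult_mat_vec_carrier[OF F z]] by simp
  then show ?thesis by (simp add: z_def t_def)
qed

section \<open>The residual bound\<close>

theorem proposition2:
  fixes n m :: nat
    and K M V Z Hbar H H\<sigma> F :: "complex mat"
    and b x r :: "complex vec"
    and \<sigma> :: complex
    and \<tau> \<theta> s :: "nat \<Rightarrow> complex"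
    and u :: "nat \<Rightarrow> complex vec"
    and \<rho> :: "nat \<Rightarrow> real"
  assumes "m \<ge> 1"
    and "K \<in> carrier_mat n n" and "invertible_mat K"
    and "M \<in> carrier_mat n n" and "invertible_mat M"
    and "b \<in> carrier_vec n" and "b \<noteq> 0\<^sub>v n"
    and "invertible_mat (K + \<sigma> \<cdot>\<^sub>m M)"
    and "\<forall>k<m. invertible_mat (K + \<tau> k \<cdot>\<^sub>m M)"
    and "flexible_arnoldi n m K M b \<tau> V Z Hbar"
    and "H = first_rows m Hbar" and "invertible_mat H"
    and "H\<sigma> = shifted_hess m H \<tau> \<sigma>" and "invertible_mat H\<sigma>"
    and "F \<in> carrier_mat m m" and "invertible_mat F"
    and "\<forall>k<m. gen_eigenpair H\<sigma> H (\<theta> k) (col F k)"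
    and "\<forall>k<m. \<theta> k + \<tau> (m - 1) - \<sigma> \<noteq> 0"
    and "\<forall>k<m. u k = V *\<^sub>v (Hbar *\<^sub>v col F k)"
    and "\<forall>k<m. \<rho> k = norm2 ((K + \<sigma> \<cdot>\<^sub>m M) *\<^sub>v (inv_mat M *\<^sub>v u k) - \<theta> k \<cdot>\<^sub>v u k)"
    and "\<forall>k<m. s k =
           (inv_mat F *\<^sub>v (inv_mat H *\<^sub>v (complex_of_real (norm2 b) \<cdot>\<^sub>v unit_vec m 0)))
             \<bullet>c unit_vec m k"
    and "ffom_approx m b \<tau> Z Hbar \<sigma> x"
    and "r = b - (K + \<sigma> \<cdot>\<^sub>m M) *\<^sub>v x"
  shows "norm2 r \<le>
    (\<Sum>k<m. \<rho> k * cmod ((\<sigma> - \<tau> (m - 1)) / (\<theta> k + \<tau> (m - 1) - \<sigma>))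
             * cmod (inverse (\<theta> k)) * cmod (s k))"
proof -
  note K = assms(2) and M = assms(4) and invM = assms(5) and b = assms(6) and b0 = assms(7)
    and ar = assms(10) and H = assms(11) and H\<sigma> = assms(13) and F = assms(15)
    and eig = assms(17) and u = assms(19) and \<rho> = assms(20) and s = assms(21)
  note C = arnoldi_carriers[OF assms(1) K M ar]
  define c where "c = complex_of_real (norm2 b) \<cdot>\<^sub>v unit_vec m 0"
  define d where "d = \<sigma> - \<tau> (m - 1)"
  define h where "h = Hbar $$ (m, m - 1)"
  define v where "v = col V m"
  have Hc: "H \<in> carrier_mat m m" and H\<sigma>c: "H\<sigma> \<in> carrier_mat m m"
    using C by (auto simp: H H\<sigma> first_rows_def shifted_hess_def mat_diag_def)
  have c: "c \<in> carrier_vec m" by (simp add: c_def)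
  obtain y where y: "y \<in> carrier_vec m" and sol: "H\<sigma> *\<^sub>v y = c" and x: "x = Z *\<^sub>v y"
    using assms(22) by (auto simp: ffom_approx_def c_def H H\<sigma>)
  define t where "t = inv_mat F *\<^sub>v (inv_mat H *\<^sub>v c)"
  have t: "t \<in> carrier_vec m"
    using invertible_mat_inv_mat(1)[OF F assms(16)] invertible_mat_inv_mat(1)[OF Hc assms(12)] c
    by (auto simp: t_def intro!: mult_mat_vec_carrier)
  \<comment> \<open>The conjugation in the scalar product leaves the real vector \<open>e\<^sub>k\<close> unchanged.\<close>
  have st: "s k = t $ k" if k: "k < m" for k
  proof -
    have "conjugate (unit_vec m k) = (unit_vec m k :: complex vec)"
      by (rule eq_vecI) (auto simp: unit_vec_def)
    then have "s k = t \<bullet> unit_vec m k"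
      using s k by (simp add: t_def c_def)
    then show ?thesis using t k by simp
  qed
  have "y = F *\<^sub>v vec m (\<lambda>k. inverse (\<theta> k) * t $ k)"
    unfolding t_def using eig
    by (intro diagonalized_pencil_solution[OF H\<sigma>c assms(14) Hc assms(12) F assms(16) _ y c sol]) auto
  then have ym: "y $ (m - 1) = (\<Sum>k<m. F $$ (m - 1, k) * (inverse (\<theta> k) * s k))"
    using F assms(1) st by (simp add: scalar_prod_def atLeast0LessThan)
  have "r = (- (d * h * y $ (m - 1))) \<cdot>\<^sub>v v"
    using ffom_residual_along_last_vector[OF assms(1) K M ar b b0 y] sol
    by (simp add: assms(23) x H\<sigma> H c_def d_def h_def v_def)
  then have "norm2 r = cmod (d * h * y $ (m - 1)) * norm2 v"
    by (simp only: norm2_smult norm_minus_cancel)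
  also have "d * h * y $ (m - 1) = (\<Sum>k<m. d * h * F $$ (m - 1, k) * inverse (\<theta> k) * s k)"
    unfolding ym by (simp add: sum_distrib_left mult.assoc)
  also have "cmod \<dots> * norm2 v
      \<le> (\<Sum>k<m. cmod (d * h * F $$ (m - 1, k) * inverse (\<theta> k) * s k)) * norm2 v"
    by (intro mult_right_mono norm_sum) (simp add: norm2_def)
  also have "\<dots> = (\<Sum>k<m. \<rho> k * cmod ((\<sigma> - \<tau> (m - 1)) / (\<theta> k + \<tau> (m - 1) - \<sigma>))
             * cmod (inverse (\<theta> k)) * cmod (s k))"
    unfolding sum_distrib_right
  proof (rule sum.cong)
    fix k assume "k \<in> {..<m}"
    then have k: "k < m" by simp
    have f: "col F k \<in> carrier_vec m" using F k by auto
    have "(K + \<sigma> \<cdot>\<^sub>m M) *\<^sub>v (inv_mat M *\<^sub>v u k) - \<theta> k \<cdot>\<^sub>v u k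
        = ((d - \<theta> k) * h * F $$ (m - 1, k)) \<cdot>\<^sub>v v"
      using eigen_residual_along_last_vector[OF assms(1) K M ar f _ invM] eig u F k assms(1)
      by (simp add: gen_eigenpair_def H H\<sigma> d_def h_def v_def)
    then have "\<rho> k = cmod (d - \<theta> k) * cmod h * cmod (F $$ (m - 1, k)) * norm2 v"
      using \<rho> k by (simp add: norm2_smult norm_mult)
    moreover have "d - \<theta> k \<noteq> 0"
      using assms(18) k by (auto simp: d_def algebra_simps)
    moreover have "cmod ((\<sigma> - \<tau> (m - 1)) / (\<theta> k + \<tau> (m - 1) - \<sigma>)) = cmod d / cmod (d - \<theta> k)"
    proof -
      have "\<theta> k + \<tau> (m - 1) - \<sigma> = \<theta> k - d"
        by (simp add: d_def)
      then show ?thesis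
        by (simp only: norm_divide norm_minus_commute flip: d_def)
    qed
    ultimately show "cmod (d * h * F $$ (m - 1, k) * inverse (\<theta> k) * s k) * norm2 v
        = \<rho> k * cmod ((\<sigma> - \<tau> (m - 1)) / (\<theta> k + \<tau> (m - 1) - \<sigma>))
             * cmod (inverse (\<theta> k)) * cmod (s k)"
      by (simp add: norm_mult)
  qed simp
  finally show ?thesis .
qed

end
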